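(* Let the kernel and domain assumptions stated in the context hold. Assume that $h\le r_\Omega$ and that $$\frac{\delta_n}{h}\le\frac{t_0}{2\left(2+\frac{\phi(\delta_n)}{\delta_n}\right)}.$$ Then for any $\mathbf x,\mathbf y\in\Omega_n$ we have $$\mathbf d_n(\mathbf x,\mathbf y)\le\left(1+\frac{4\delta_n}{t_0h}+\frac{2\phi(\delta_n)}{t_0h}\right)d_\Omega(\mathbf x,\mathbf y)+\tau_\eta h,$$ where $\tau_\eta:=\sup_{0<t\le t_0}\{\sigma_\eta\,\eta(t)^{-1}-t\}$.
   Context: Notation: $a\vee b=\max\{a,b\}$, $|\cdot|$ is the Euclidean norm. Domain. $\Omega\subset\mathbb R^d$ is an open bounded domain, and $d_\Omega(x,y)=\inf\{\int_0^1|\dot\xi(t)|\,dt:\ \xi\in C^1([0,1];\overline\Omega),\ \xi(0)=x,\ \xi(1)=y\}$ for $x,y\in\overline\Omega$. Domain assumption: there are $\phi:[0,\infty)\to[0,\infty)$ with $\lim_{h\downarrow0}\phi(h)/h=0$ and $r_\Omega>0$ such that $d_\Omega(x,y)\le|x-y|+\phi(|x-y|)$ for all $x,y\in\Omega$ with $|x-y|\le r_\Omega$. Point clouds. $\mathcal O\subset\overline\Omega$ is nonempty and closed, $\Omega_n\subset\overline\Omega$ is a finite point cloud and $\mathcal O_n\subset\Omega_n$ is nonempty. With $d_H(A,B)=\sup_{x\in A}\inf_{y\in B}|x-y|\vee\sup_{x\in B}\inf_{y\in A}|x-y|$, the graph resolution is $\delta_n=d_H(\Omega_n,\overline\Omega)\vee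 d_H(\mathcal O_n,\mathcal O)$. Kernel assumption: $\eta:(0,\infty)\to[0,\infty)$ is nonincreasing with $\operatorname{supp}\eta\subset[0,1]$, $\sigma_\eta:=\sup_{t>0}t\eta(t)\in(0,\infty)$, and there exists $t_0\in(0,1]$ (chosen as the largest number with this property) with $\sigma_\eta=t_0\eta(t_0)$. Graph with length scale $h>0$. Weights on $\Omega_n$: $\mathbf w_n(\mathbf x,\mathbf y)=\frac1{\sigma_\eta h}\eta\left(\frac{|\mathbf x-\mathbf y|}h\right)$ for $\mathbf x\ne\mathbf y$ and $0$ for $\mathbf x=\mathbf y$. Graph distance: $\mathbf d_n(\mathbf x,\mathbf x)=0$ and, for $\mathbf x\ne\mathbf y$, $\mathbf d_n(\mathbf x,\mathbf y)=\min\{\sum_{i=1}^N\mathbf w_n(\mathbf x_{i-1},\mathbf x_i)^{-1}\}$ over all $N\in\mathbb N$ and finite sequences in $\Omega_n$ with $\mathbf x_0=\mathbf x$, $\mathbf x_N=\mathbf y$ (with $0^{-1}=\infty$). *)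

theory Defs
  imports "HOL-Analysis.Analysis"
begin

section \<open>Geodesic distance and the domain assumption\<close>

text \<open>At the end points of \<open>[0,1]\<close> the derivatives are one-sided.\<close>

definition C1_curve :: "'a::euclidean_space set \<Rightarrow> 'a \<Rightarrow> 'a \<Rightarrow> (real \<Rightarrow> 'a) \<Rightarrow> (real \<Rightarrow> 'a) \<Rightarrow> bool" where
  "C1_curve S x y \<xi> \<xi>' \<longleftrightarrow>
     (\<forall>t\<in>{0..1}. (\<xi> has_vector_derivative \<xi>' t) (at t within {0..1})) \<and>
     continuous_on {0..1} \<xi>' \<and> \<xi> ` {0..1} \<subseteq> S \<and> \<xi> 0 = x \<and> \<xi> 1 = y"

text \<open>The infimum is taken in the extended nonnegative reals, so that it is \<open>\<infinity>\<close> if there is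
  no admissible curve.\<close>

definition geodesic_dist :: "'a::euclidean_space set \<Rightarrow> 'a \<Rightarrow> 'a \<Rightarrow> ennreal" where
  "geodesic_dist \<Omega> x y =
     Inf {ennreal (integral {0..1} (\<lambda>t. norm (\<xi>' t))) |\<xi> \<xi>'. C1_curve (closure \<Omega>) x y \<xi> \<xi>'}"

definition bounded_domain :: "'a::euclidean_space set \<Rightarrow> bool" where
  "bounded_domain \<Omega> \<longleftrightarrow> open \<Omega> \<and> connected \<Omega> \<and> \<Omega> \<noteq> {} \<and> bounded \<Omega>"

text \<open>Only the values of \<open>\<phi>\<close> on \<open>[0,\<infinity>)\<close> are constrained (and used).\<close>

definition domain_assumption :: "'a::euclidean_space set \<Rightarrow> (real \<Rightarrow> real) \<Rightarrow> real \<Rightarrow> bool" where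
  "domain_assumption \<Omega> \<phi> r \<longleftrightarrow>
     (\<forall>s\<ge>0. 0 \<le> \<phi> s) \<and> ((\<lambda>s. \<phi> s / s) \<longlongrightarrow> 0) (at_right 0) \<and> 0 < r \<and>
     (\<forall>x\<in>\<Omega>. \<forall>y\<in>\<Omega>. norm (x - y) \<le> r \<longrightarrow>
        geodesic_dist \<Omega> x y \<le> ennreal (norm (x - y) + \<phi> (norm (x - y))))"


section \<open>Graph resolution\<close>

text \<open>Only used for nonempty bounded sets, for which all suprema and infima are those of
  nonempty bounded sets of reals.\<close>

definition hausdorff_dist :: "'a::euclidean_space set \<Rightarrow> 'a set \<Rightarrow> real" where
  "hausdorff_dist A B =
     max (SUP x\<in>A. INF y\<in>B. norm (x - y)) (SUP x\<in>B. INF y\<in>A. norm (x - y))"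

definition resolution ::
  "'a::euclidean_space set \<Rightarrow> 'a set \<Rightarrow> 'a set \<Rightarrow> 'a set \<Rightarrow> real" where
  "resolution \<Omega> \<O> \<Omega>n \<O>n = max (hausdorff_dist \<Omega>n (closure \<Omega>)) (hausdorff_dist \<O>n \<O>)"


section \<open>Kernel\<close>

text \<open>Only the values of \<open>\<eta>\<close> on \<open>(0,\<infinity>)\<close> are constrained (and used).\<close>

definition sigma_eta :: "(real \<Rightarrow> real) \<Rightarrow> real" where
  "sigma_eta \<eta> = (SUP t\<in>{0<..}. t * \<eta> t)"

text \<open>Boundedness of \<open>t * \<eta> t\<close> expresses \<open>\<sigma>\<^sub>\<eta> < \<infinity>\<close>.\<close>

definition kernel_assumption :: "(real \<Rightarrow> real) \<Rightarrow> real \<Rightarrow> bool" where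
  "kernel_assumption \<eta> t0 \<longleftrightarrow>
     (\<forall>t>0. 0 \<le> \<eta> t) \<and> antimono_on {0<..} \<eta> \<and>
     closure {t. 0 < t \<and> \<eta> t \<noteq> 0} \<subseteq> {0..1} \<and>
     bdd_above ((\<lambda>t. t * \<eta> t) ` {0<..}) \<and> 0 < sigma_eta \<eta> \<and>
     t0 \<in> {0<..1} \<and> sigma_eta \<eta> = t0 * \<eta> t0 \<and>
     (\<forall>t\<in>{0<..1}. sigma_eta \<eta> = t * \<eta> t \<longrightarrow> t \<le> t0)"

text \<open>Under the kernel assumption \<open>\<eta> t \<ge> \<eta> t0 > 0\<close> for \<open>0 < t \<le> t0\<close>, so the supremum is
  over a nonempty set of reals bounded above by \<open>t0\<close>.\<close>

definition tau_eta :: "(real \<Rightarrow> real) \<Rightarrow> real \<Rightarrow> real" where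
  "tau_eta \<eta> t0 = (SUP t\<in>{0<..t0}. sigma_eta \<eta> * inverse (\<eta> t) - t)"


section \<open>Weighted graph\<close>

definition weight :: "(real \<Rightarrow> real) \<Rightarrow> real \<Rightarrow> 'a::euclidean_space \<Rightarrow> 'a \<Rightarrow> real" where
  "weight \<eta> h x y =
     (if x = y then 0 else 1 / (sigma_eta \<eta> * h) * \<eta> (norm (x - y) / h))"

text \<open>In \<^typ>\<open>ennreal\<close> we have \<open>inverse 0 = \<infinity>\<close>. The infimum is a minimum for finite \<open>V\<close>: then the
  summands range over a finite set of positive extended reals, so below any finite bound there
  are only finitely many values of the sum.\<close>

definition graph_dist ::
  "(real \<Rightarrow> real) \<Rightarrow> real \<Rightarrow> 'a::euclidean_space set \<Rightarrow> 'a \<Rightarrow> 'a \<Rightarrow> ennreal" where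
  "graph_dist \<eta> h V x y =
     (if x = y then 0
      else Inf {\<Sum>i=1..N. inverse (ennreal (weight \<eta> h (p (i - 1)) (p i))) |(N::nat) p.
                  (\<forall>i\<le>N. p i \<in> V) \<and> p 0 = x \<and> p N = y})"

end

theory Submission
  imports Defs
begin

text \<open>
  Write \<open>\<rho> = t0 * h\<close>. The kernel assumption makes every edge of length at most \<open>\<rho>\<close> cheap in two
  ways: crossing it costs at most \<open>\<rho>\<close>, because \<open>\<eta>\<close> is nonincreasing and \<open>\<sigma>\<^sub>\<eta> = t0 * \<eta> t0\<close>, and
  it costs at most its length plus \<open>\<tau>\<^sub>\<eta> * h\<close>, by definition of \<open>\<tau>\<^sub>\<eta>\<close> (\<open>edge_cost\<close>).

  Let a curve of length \<open>L\<close> in the closed domain join \<open>x\<close> to \<open>y\<close>. Every point of it has a vertex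
  within distance \<open>\<delta>\<close>. Hence vertices that shadow two points of the curve at arc length distance
  \<open>s = \<rho> - 2 * \<delta>\<close> are at most \<open>\<rho>\<close> apart, and a hop between them costs \<open>\<rho>\<close> for a progress \<open>s\<close>:
  an excess of \<open>2 * \<delta>\<close> per hop. With at most \<open>L / s\<close> such hops the total excess is at most
  \<open>2 * \<delta> * L / s\<close>. A further hop is needed to land on \<open>y\<close>; if it were paid at the price \<open>\<rho>\<close>
  it would add a full \<open>\<rho>\<close> to the bound, so it is paid at the second price, as length plus
  \<open>\<tau>\<^sub>\<eta> * h\<close>. This term therefore enters only once (\<open>cost_along_lipschitz_curve\<close>).

  As \<open>\<phi> \<delta> \<ge> 0\<close>, the bound on \<open>\<delta> / h\<close> gives \<open>\<delta> \<le> \<rho> / 4\<close>, so that \<open>s \<ge> \<rho> / 2\<close> and the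
  relative excess \<open>2 * \<delta> / s\<close> is at most \<open>4 * \<delta> / \<rho>\<close>. Taking the infimum over all curves
  concludes the proof.
\<close>

section \<open>Edge costs and graph distance\<close>

lemma ennreal_le_affine_Inf:
  fixes G k :: ennreal
  assumes c: "0 < c" and le: "\<And>l. l \<in> S \<Longrightarrow> G \<le> ennreal c * l + k"
  shows "G \<le> ennreal c * Inf S + k"
proof (cases "k = top")
  case True
  then show ?thesis by simp
next
  case False
  have "(G - k) / ennreal c \<le> Inf S"
  proof (rule Inf_greatest)
    fix l assume "l \<in> S"
    then have "G - k \<le> ennreal c * l"
      using le[of l] False by (simp add: ennreal_minus_le_iff add.commute)
    then show "(G - k) / ennreal c \<le> l"
      using c by (intro divide_le_posI_ennreal) (auto simp: mult.commute)
  qed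
  then have "ennreal c * ((G - k) / ennreal c) \<le> ennreal c * Inf S"
    by (rule mult_left_mono) simp
  moreover have "ennreal c * ((G - k) / ennreal c) = G - k"
    using c ennreal_mult_divide_eq[of "ennreal c" "G - k"]
    by (simp add: ennreal_times_divide mult.commute)
  ultimately show ?thesis
    using False by (simp add: ennreal_minus_le_iff add.commute)
qed

lemma graph_dist_extend:
  assumes "x \<in> V" "y \<in> V" "z \<in> V"
  shows "graph_dist \<eta> h V x z \<le> graph_dist \<eta> h V x y + inverse (ennreal (weight \<eta> h y z))"
proof -
  have path: "graph_dist \<eta> h V x z \<le> (\<Sum>i=1..N. inverse (ennreal (weight \<eta> h (p (i - 1)) (p i))))"
    if "\<forall>i\<le>N. p i \<in> V" "p 0 = x" "p N = z" for N and p :: "nat \<Rightarrow> 'a"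
    using that by (auto simp: graph_dist_def intro!: Inf_lower)
  show ?thesis
  proof (cases "x = y")
    case True
    with path[of 1 "\<lambda>i. if i = 0 then x else z"] assms show ?thesis
      by (simp add: graph_dist_def)
  next
    case False
    let ?S = "{\<Sum>i=1..N. inverse (ennreal (weight \<eta> h (p (i - 1)) (p i))) |(N::nat) p.
                  (\<forall>i\<le>N. p i \<in> V) \<and> p 0 = x \<and> p N = y}"
    have "graph_dist \<eta> h V x z \<le> ennreal 1 * Inf ?S + inverse (ennreal (weight \<eta> h y z))"
    proof (rule ennreal_le_affine_Inf)
      fix l assume "l \<in> ?S"
      then obtain N :: nat and p where l: "l = (\<Sum>i=1..N. inverse (ennreal (weight \<eta> h (p (i - 1)) (p i))))"
        and p: "\<forall>i\<le>N. p i \<in> V" "p 0 = x" "p N = y"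
        by blast
      let ?q = "p(Suc N := z)"
      have "graph_dist \<eta> h V x z
          \<le> (\<Sum>i=1..Suc N. inverse (ennreal (weight \<eta> h (?q (i - 1)) (?q i))))"
        using p assms by (intro path) auto
      also have "\<dots> = (\<Sum>i=1..N. inverse (ennreal (weight \<eta> h (?q (i - 1)) (?q i))))
          + inverse (ennreal (weight \<eta> h y z))"
        using p by simp
      also have "(\<Sum>i=1..N. inverse (ennreal (weight \<eta> h (?q (i - 1)) (?q i)))) = l"
        unfolding l by (rule sum.cong) auto
      finally show "graph_dist \<eta> h V x z \<le> ennreal 1 * l + inverse (ennreal (weight \<eta> h y z))"
        by simp
    qed simp
    with False show ?thesis
      by (simp add: graph_dist_def)
  qed
qed

lemma kernel_bounds:
  assumes "kernel_assumption \<eta> t0" "0 < t" "t \<le> t0"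
  shows "0 < \<eta> t" and "sigma_eta \<eta> * inverse (\<eta> t) \<le> t0"
    and "sigma_eta \<eta> * inverse (\<eta> t) \<le> t + tau_eta \<eta> t0" and "0 \<le> tau_eta \<eta> t0"
proof -
  have t0: "0 < t0" and \<sigma>: "0 < sigma_eta \<eta>" "sigma_eta \<eta> = t0 * \<eta> t0"
    and mono: "antimono_on {0<..} \<eta>"
    using assms by (auto simp: kernel_assumption_def)
  have \<eta>0: "0 < \<eta> t0"
    using t0 \<sigma> by (simp add: zero_less_mult_iff)
  have \<eta>: "\<eta> t0 \<le> \<eta> s" if "0 < s" "s \<le> t0" for s
    using mono that by (auto simp: monotone_on_def)
  have cost: "sigma_eta \<eta> * inverse (\<eta> s) \<le> t0" if "0 < s" "s \<le> t0" for s
    using \<eta>[OF that] \<eta>0 t0 unfolding \<sigma>(2) by (simp add: field_simps)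
  have "bdd_above ((\<lambda>s. sigma_eta \<eta> * inverse (\<eta> s) - s) ` {0<..t0})"
  proof (rule bdd_aboveI2)
    show "sigma_eta \<eta> * inverse (\<eta> s) - s \<le> t0" if "s \<in> {0<..t0}" for s
      using that cost[of s] by auto
  qed
  then have tau: "sigma_eta \<eta> * inverse (\<eta> s) - s \<le> tau_eta \<eta> t0" if "s \<in> {0<..t0}" for s
    unfolding tau_eta_def using that by (rule cSUP_upper[rotated])
  show "0 < \<eta> t" using \<eta>[OF assms(2,3)] \<eta>0 by simp
  show "sigma_eta \<eta> * inverse (\<eta> t) \<le> t0" using cost assms by blast
  show "sigma_eta \<eta> * inverse (\<eta> t) \<le> t + tau_eta \<eta> t0" using tau[of t] assms by simp
  show "0 \<le> tau_eta \<eta> t0" using tau[of t0] t0 \<eta>0 \<sigma>(2) by (simp add: field_simps)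
qed

lemma edge_cost:
  assumes "kernel_assumption \<eta> t0" "0 < h" "u \<noteq> v" "norm (u - v) \<le> t0 * h"
  shows "inverse (ennreal (weight \<eta> h u v)) \<le> ennreal (t0 * h)"
    and "inverse (ennreal (weight \<eta> h u v)) \<le> ennreal (norm (u - v) + tau_eta \<eta> t0 * h)"
proof -
  define t where "t = norm (u - v) / h"
  have t: "0 < t" "t \<le> t0" "norm (u - v) = t * h"
    using assms by (auto simp: t_def field_simps)
  have \<sigma>: "0 < sigma_eta \<eta>"
    using assms by (simp add: kernel_assumption_def)
  note bounds = kernel_bounds[OF assms(1) t(1,2)]
  have "weight \<eta> h u v = inverse (sigma_eta \<eta> * inverse (\<eta> t) * h)"
    using assms(3) by (simp add: weight_def t_def field_simps)
  then have "inverse (ennreal (weight \<eta> h u v)) = ennreal (sigma_eta \<eta> * inverse (\<eta> t) * h)"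
    using \<sigma> bounds(1) assms(2) by (simp add: inverse_ennreal)
  moreover have "sigma_eta \<eta> * inverse (\<eta> t) * h \<le> t0 * h"
    using bounds(2) assms(2) by (intro mult_right_mono) auto
  moreover have "sigma_eta \<eta> * inverse (\<eta> t) * h \<le> norm (u - v) + tau_eta \<eta> t0 * h"
    using mult_right_mono[OF bounds(3), of h] assms(2) t(3) by (simp add: algebra_simps)
  ultimately show "inverse (ennreal (weight \<eta> h u v)) \<le> ennreal (t0 * h)"
    and "inverse (ennreal (weight \<eta> h u v)) \<le> ennreal (norm (u - v) + tau_eta \<eta> t0 * h)"
    by (simp_all add: ennreal_leI)
qed

text \<open>The graph distance absorbs the degenerate hop \<open>u = v\<close>, whose weight \<open>0\<close> would make it
  infinitely expensive. Shadowing vertices may coincide, hence the bounds on hops are stated for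
  the distance and not for single edges.\<close>

lemma graph_dist_hop:
  assumes "kernel_assumption \<eta> t0" "0 < h" "x \<in> V" "u \<in> V" "v \<in> V" "norm (u - v) \<le> t0 * h"
  shows "graph_dist \<eta> h V x v \<le> graph_dist \<eta> h V x u + ennreal (t0 * h)"
    and "graph_dist \<eta> h V x v
         \<le> graph_dist \<eta> h V x u + ennreal (norm (u - v) + tau_eta \<eta> t0 * h)"
proof -
  have *: "graph_dist \<eta> h V x v \<le> graph_dist \<eta> h V x u + ennreal c"
    if "u \<noteq> v \<Longrightarrow> inverse (ennreal (weight \<eta> h u v)) \<le> ennreal c" for c
  proof (cases "u = v")
    case False
    have "graph_dist \<eta> h V x v \<le> graph_dist \<eta> h V x u + inverse (ennreal (weight \<eta> h u v))"
      using assms by (intro graph_dist_extend)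
    also have "\<dots> \<le> graph_dist \<eta> h V x u + ennreal c"
      using that[OF False] by (rule add_left_mono)
    finally show ?thesis .
  qed simp
  show "graph_dist \<eta> h V x v \<le> graph_dist \<eta> h V x u + ennreal (t0 * h)"
    and "graph_dist \<eta> h V x v
         \<le> graph_dist \<eta> h V x u + ennreal (norm (u - v) + tau_eta \<eta> t0 * h)"
    using edge_cost[OF assms(1,2) _ assms(6)] by (auto intro: *)
qed


section \<open>Hopping along a curve\<close>

text \<open>Reparametrisation by arc length. As the speed may vanish, the inverse of the arc length
  function \<open>F\<close> is not a function; any selection will do, because \<open>\<xi>\<close> is constant wherever \<open>F\<close>
  is.\<close>

lemma C1_curve_lipschitz_reparametrisation:
  assumes "C1_curve S x y \<xi> \<xi>'"
  defines "L \<equiv> integral {0..1} (\<lambda>t. norm (\<xi>' t))"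
  obtains \<gamma> where "0 \<le> L" "\<gamma> 0 = x" "\<gamma> L = y" "\<gamma> ` {0..L} \<subseteq> S"
    "\<And>u v. u \<in> {0..L} \<Longrightarrow> v \<in> {0..L} \<Longrightarrow> norm (\<gamma> u - \<gamma> v) \<le> \<bar>u - v\<bar>"
proof -
  have deriv: "\<And>t. t \<in> {0..1} \<Longrightarrow> (\<xi> has_vector_derivative \<xi>' t) (at t within {0..1})"
    and cont: "continuous_on {0..1} \<xi>'" and S: "\<xi> ` {0..1} \<subseteq> S" and ends: "\<xi> 0 = x" "\<xi> 1 = y"
    using assms(1) by (auto simp: C1_curve_def)
  define F where "F t = integral {0..t} (\<lambda>t. norm (\<xi>' t))" for t
  have int: "(\<lambda>t. norm (\<xi>' t)) integrable_on {0..1}"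
    using cont by (intro integrable_continuous_real continuous_on_norm)
  have incr: "norm (\<xi> t - \<xi> s) \<le> F t - F s" if "0 \<le> s" "s \<le> t" "t \<le> 1" for s t
  proof -
    have sub: "{s..t} \<subseteq> {0..1}" using that by auto
    have 1: "(\<xi>' has_integral (\<xi> t - \<xi> s)) {s..t}"
      using that sub
      by (intro fundamental_theorem_of_calculus)
         (auto intro: has_vector_derivative_within_subset[OF deriv])
    have 2: "(\<lambda>t. norm (\<xi>' t)) integrable_on {s..t}"
      using int sub by (rule integrable_on_subinterval)
    have "norm (\<xi> t - \<xi> s) \<le> integral {s..t} (\<lambda>t. norm (\<xi>' t))"
      using integral_norm_bound_integral[of \<xi>' "{s..t}" "\<lambda>t. norm (\<xi>' t)"] 1 2
      by (auto simp: has_integral_integrable integral_unique)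
    also have "F s + integral {s..t} (\<lambda>t. norm (\<xi>' t)) = F t"
      unfolding F_def using that int
      by (intro Henstock_Kurzweil_Integration.integral_combine)
         (auto intro: integrable_on_subinterval)
    then have "integral {s..t} (\<lambda>t. norm (\<xi>' t)) = F t - F s" by simp
    finally show ?thesis .
  qed
  have F: "F 0 = 0" "F 1 = L" "continuous_on {0..1} F"
    unfolding F_def L_def using indefinite_integral_continuous_1[OF int] by auto
  have lip: "norm (\<xi> t - \<xi> s) \<le> \<bar>F t - F s\<bar>" if "s \<in> {0..1}" "t \<in> {0..1}" for s t
    using that incr[of s t] incr[of t s] by (cases "s \<le> t") (auto simp: norm_minus_commute)
  have "\<forall>u. \<exists>t. u \<in> {0..L} \<longrightarrow> t \<in> {0..1} \<and> F t = u"
    using IVT'[of F 0 _ 1] F by fastforce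
  then obtain T where T: "\<And>u. u \<in> {0..L} \<Longrightarrow> T u \<in> {0..1} \<and> F (T u) = u"
    by metis
  have L: "0 \<le> L"
    unfolding L_def using int by (intro integral_nonneg) auto
  show ?thesis
  proof (rule that[of "\<xi> \<circ> T"])
    show "0 \<le> L" by fact
    show "(\<xi> \<circ> T) 0 = x" "(\<xi> \<circ> T) L = y"
      using lip[of "T 0" 0] T[of 0] lip[of "T L" 1] T[of L] L F ends by auto
    show "(\<xi> \<circ> T) ` {0..L} \<subseteq> S" using T S by auto
    show "norm ((\<xi> \<circ> T) u - (\<xi> \<circ> T) v) \<le> \<bar>u - v\<bar>" if "u \<in> {0..L}" "v \<in> {0..L}" for u v
      using lip[of "T v" "T u"] T[of u] T[of v] that by auto
  qed
qed

text \<open>Here \<open>D v\<close> stands for the cost of reaching \<open>v\<close> from the start of the curve, and the two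
  assumptions on hops are the two prices of a hop. The \<open>n\<close>-th hop starts near \<open>\<gamma> (\<delta> + n * s)\<close>:
  the offset \<open>\<delta>\<close> expresses that the first hop leaves from a point of the curve exactly, and it
  pays for the last hop, which leaves from a vertex only near the curve. Without it the final
  bound would carry an additional \<open>\<delta>\<close>.\<close>

lemma cost_along_lipschitz_curve:
  fixes \<gamma> :: "real \<Rightarrow> 'a::euclidean_space" and D :: "'a \<Rightarrow> ennreal"
  assumes start: "D (\<gamma> 0) = 0"
    and lip: "\<And>u v. u \<in> {0..L} \<Longrightarrow> v \<in> {0..L} \<Longrightarrow> norm (\<gamma> u - \<gamma> v) \<le> \<bar>u - v\<bar>"
    and near: "\<And>u. u \<in> {0..L} \<Longrightarrow> \<exists>v\<in>V. norm (\<gamma> u - v) \<le> \<delta>"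
    and ends: "\<gamma> 0 \<in> V" "\<gamma> L \<in> V"
    and nonneg: "0 \<le> L" "0 \<le> \<delta>" "2 * \<delta> < \<rho>" "0 \<le> \<tau>"
    and long: "\<And>u v. u \<in> V \<Longrightarrow> v \<in> V \<Longrightarrow> norm (u - v) \<le> \<rho> \<Longrightarrow> D v \<le> D u + ennreal \<rho>"
    and short: "\<And>u v. u \<in> V \<Longrightarrow> v \<in> V \<Longrightarrow> norm (u - v) \<le> \<rho>
                  \<Longrightarrow> D v \<le> D u + ennreal (norm (u - v) + \<tau>)"
  shows "D (\<gamma> L) \<le> ennreal ((1 + 2 * \<delta> / (\<rho> - 2 * \<delta>)) * L + \<tau>)"
proof (cases "L < \<delta>")
  case True
  have dist: "norm (\<gamma> 0 - \<gamma> L) \<le> L"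
    using lip[of 0 L] nonneg by simp
  have "D (\<gamma> L) \<le> ennreal (norm (\<gamma> 0 - \<gamma> L) + \<tau>)"
    using short[of "\<gamma> 0" "\<gamma> L"] start ends dist True nonneg by simp
  also have "\<dots> \<le> ennreal ((1 + 2 * \<delta> / (\<rho> - 2 * \<delta>)) * L + \<tau>)"
  proof (rule ennreal_leI)
    have "0 \<le> 2 * \<delta> / (\<rho> - 2 * \<delta>) * L" using nonneg by simp
    then show "norm (\<gamma> 0 - \<gamma> L) + \<tau> \<le> (1 + 2 * \<delta> / (\<rho> - 2 * \<delta>)) * L + \<tau>"
      using dist by (simp add: ring_distribs)
  qed
  finally show ?thesis .
next
  case False
  define s where "s = \<rho> - 2 * \<delta>"
  have s: "0 < s" using nonneg by (simp add: s_def)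
  have hops: "\<exists>v\<in>V. norm (\<gamma> (\<delta> + n * s) - v) \<le> \<delta> \<and> D v \<le> ennreal (n * \<rho>)"
    if "\<delta> + n * s \<le> L" for n :: nat
    using that
  proof (induction n)
    case 0
    have "norm (\<gamma> \<delta> - \<gamma> 0) \<le> \<delta>"
      using lip[of \<delta> 0] 0 nonneg by simp
    then show ?case using start ends by auto
  next
    case (Suc n)
    have range: "\<delta> + n * s \<in> {0..L}" "\<delta> + Suc n * s \<in> {0..L}"
      using Suc.prems s nonneg by (auto simp: algebra_simps)
    obtain v where v: "v \<in> V" "norm (\<gamma> (\<delta> + n * s) - v) \<le> \<delta>" "D v \<le> ennreal (n * \<rho>)"
      using Suc.IH range by auto
    obtain w where w: "w \<in> V" "norm (\<gamma> (\<delta> + Suc n * s) - w) \<le> \<delta>"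
      using near range by blast
    have "norm (\<gamma> (\<delta> + n * s) - \<gamma> (\<delta> + Suc n * s)) \<le> s"
      using lip[OF range] s by (simp add: algebra_simps)
    then have "norm (v - w) \<le> \<rho>"
      using v w unfolding s_def by norm
    then have "D w \<le> D v + ennreal \<rho>"
      using long v w by blast
    also have "\<dots> \<le> ennreal (n * \<rho>) + ennreal \<rho>"
      using v by (intro add_right_mono)
    also have "\<dots> = ennreal (Suc n * \<rho>)"
      using nonneg by (subst ennreal_plus[symmetric]) (auto simp: algebra_simps)
    finally show ?case using w by blast
  qed
  define n where "n = nat \<lfloor>(L - \<delta>) / s\<rfloor>"
  have n: "real n = of_int \<lfloor>(L - \<delta>) / s\<rfloor>"
    using False s by (simp add: n_def)
  have "n \<le> (L - \<delta>) / s" "(L - \<delta>) / s < real n + 1"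
    unfolding n by linarith+
  then have ns: "\<delta> + n * s \<le> L" "L < \<delta> + n * s + s"
    using s by (simp_all add: field_simps)
  obtain v where v: "v \<in> V" "norm (\<gamma> (\<delta> + n * s) - v) \<le> \<delta>" "D v \<le> ennreal (n * \<rho>)"
    using hops ns by blast
  have "norm (\<gamma> (\<delta> + n * s) - \<gamma> L) \<le> L - (\<delta> + n * s)"
    using lip[of "\<delta> + n * s" L] ns nonneg s by simp
  then have last: "norm (v - \<gamma> L) \<le> L - n * s"
    using norm_diff_triangle_le[of v "\<gamma> (\<delta> + n * s)" \<delta> "\<gamma> L" "L - (\<delta> + n * s)"] v
    by (simp add: norm_minus_commute)
  then have "norm (v - \<gamma> L) \<le> \<rho>"
    using ns nonneg by (simp add: s_def)
  then have "D (\<gamma> L) \<le> D v + ennreal (norm (v - \<gamma> L) + \<tau>)"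
    using short v ends by blast
  also have "\<dots> \<le> ennreal (n * \<rho>) + ennreal (L - n * s + \<tau>)"
    using v last by (intro add_mono ennreal_leI) auto
  also have "\<dots> = ennreal (L + 2 * \<delta> * n + \<tau>)"
    using ns nonneg by (subst ennreal_plus[symmetric]) (auto simp: s_def algebra_simps)
  also have "\<dots> \<le> ennreal ((1 + 2 * \<delta> / s) * L + \<tau>)"
  proof (rule ennreal_leI)
    have "n \<le> L / s" using ns nonneg s by (simp add: field_simps)
    then have "2 * \<delta> * n \<le> 2 * \<delta> * (L / s)"
      using nonneg by (intro mult_left_mono) auto
    then show "L + 2 * \<delta> * n + \<tau> \<le> (1 + 2 * \<delta> / s) * L + \<tau>"
      by (simp add: algebra_simps)
  qed
  finally show ?thesis by (simp add: s_def)
qed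

lemma resolution_nearest:
  assumes "bounded \<Omega>" "finite \<Omega>n" "\<Omega>n \<noteq> {}" "z \<in> closure \<Omega>"
  shows "\<exists>v\<in>\<Omega>n. norm (z - v) \<le> resolution \<Omega> \<O> \<Omega>n \<O>n"
proof -
  let ?d = "\<lambda>z. INF v\<in>\<Omega>n. norm (z - v)"
  obtain v0 where v0: "v0 \<in> \<Omega>n" using assms by blast
  obtain B where B: "\<And>z. z \<in> closure \<Omega> \<Longrightarrow> norm z \<le> B"
    using bounded_closure[OF assms(1)] unfolding bounded_iff by blast
  have "bdd_above (?d ` closure \<Omega>)"
  proof (rule bdd_aboveI2)
    fix z assume z: "z \<in> closure \<Omega>"
    have "?d z \<le> norm (z - v0)"
      using v0 assms(2) by (intro cINF_lower bdd_below_finite finite_imageI)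
    also have "\<dots> \<le> B + norm v0" using B[OF z] norm_triangle_ineq4[of z v0] by linarith
    finally show "?d z \<le> B + norm v0" .
  qed
  from cSUP_upper[OF assms(4) this]
  have le: "?d z \<le> resolution \<Omega> \<O> \<Omega>n \<O>n"
    unfolding resolution_def hausdorff_dist_def by linarith
  obtain v where v: "v \<in> \<Omega>n" "\<And>w. w \<in> \<Omega>n \<Longrightarrow> norm (z - v) \<le> norm (z - w)"
    using arg_min_if_finite[OF assms(2,3), of "\<lambda>v. norm (z - v)"] by force
  then have "norm (z - v) \<le> ?d z"
    using assms(3) by (intro cINF_greatest)
  then show ?thesis using le v by force
qed


section \<open>Comparison with the geodesic distance\<close>

theorem lemma5p5:
  fixes \<Omega> \<O> \<Omega>n \<O>n :: "'a::euclidean_space set"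
    and \<phi> \<eta> :: "real \<Rightarrow> real"
    and r\<Omega> t0 h :: real
    and x y :: 'a
  defines "\<delta> \<equiv> resolution \<Omega> \<O> \<Omega>n \<O>n"
  assumes "bounded_domain \<Omega>"
    and "domain_assumption \<Omega> \<phi> r\<Omega>"
    and "\<O> \<noteq> {}" and "closed \<O>" and "\<O> \<subseteq> closure \<Omega>"
    and "finite \<Omega>n" and "\<Omega>n \<subseteq> closure \<Omega>"
    and "\<O>n \<noteq> {}" and "\<O>n \<subseteq> \<Omega>n"
    and "kernel_assumption \<eta> t0"
    and "0 < h" and "h \<le> r\<Omega>"
    and "\<delta> / h \<le> t0 / (2 * (2 + \<phi> \<delta> / \<delta>))"
    and "x \<in> \<Omega>n" and "y \<in> \<Omega>n"
  shows "graph_dist \<eta> h \<Omega>n x y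
         \<le> ennreal (1 + 4 * \<delta> / (t0 * h) + 2 * \<phi> \<delta> / (t0 * h)) * geodesic_dist \<Omega> x y
           + ennreal (tau_eta \<eta> t0 * h)"
proof -
  let ?\<rho> = "t0 * h" and ?\<tau> = "tau_eta \<eta> t0 * h"
  let ?c = "1 + 4 * \<delta> / ?\<rho> + 2 * \<phi> \<delta> / ?\<rho>"
  have near: "\<exists>v\<in>\<Omega>n. norm (z - v) \<le> \<delta>" if "z \<in> closure \<Omega>" for z
    unfolding \<delta>_def using assms that
    by (intro resolution_nearest) (auto simp: bounded_domain_def)
  have \<delta>: "0 \<le> \<delta>"
  proof -
    obtain v where "norm (x - v) \<le> \<delta>"
      using near[of x] assms(8,15) by blast
    then show ?thesis using norm_ge_zero[of "x - v"] by linarith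
  qed
  have \<phi>: "0 \<le> \<phi> \<delta>"
    using assms(3) \<delta> by (simp add: domain_assumption_def)
  have t0: "0 < t0" and \<rho>: "0 < ?\<rho>"
    using assms by (auto simp: kernel_assumption_def)
  have \<tau>: "0 \<le> ?\<tau>"
    using kernel_bounds(4)[OF assms(11) t0] assms(12) by simp
  (* This also covers the convention \<phi> \<delta> / \<delta> = 0 for \<delta> = 0. *)
  have "0 \<le> \<phi> \<delta> / \<delta>" using \<phi> \<delta> by simp
  then have "t0 / (2 * (2 + \<phi> \<delta> / \<delta>)) \<le> t0 / 4"
    using t0 by (intro frac_le) auto
  with assms(14) have "\<delta> / h \<le> t0 / 4" by linarith
  then have quarter: "4 * \<delta> \<le> ?\<rho>"
    using assms(12) by (simp add: field_simps)
  have "2 * \<delta> / (?\<rho> - 2 * \<delta>) \<le> 2 * \<delta> / (?\<rho> / 2)"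
  proof (rule frac_le)
    show "?\<rho> / 2 \<le> ?\<rho> - 2 * \<delta>" using quarter by linarith
  qed (use \<delta> \<rho> in auto)
  also have "\<dots> = 4 * \<delta> / ?\<rho>" by simp
  also have "\<dots> \<le> 4 * \<delta> / ?\<rho> + 2 * \<phi> \<delta> / ?\<rho>" using \<phi> \<rho> by simp
  finally have factor: "1 + 2 * \<delta> / (?\<rho> - 2 * \<delta>) \<le> ?c" by simp
  have c: "0 < ?c" using \<delta> \<phi> \<rho> by (intro add_pos_nonneg) auto
  show ?thesis
    unfolding geodesic_dist_def
  proof (rule ennreal_le_affine_Inf[OF c])
    fix l assume "l \<in> {ennreal (integral {0..1} (\<lambda>t. norm (\<xi>' t))) |\<xi> \<xi>'.
                        C1_curve (closure \<Omega>) x y \<xi> \<xi>'}"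
    then obtain \<xi> \<xi>' where l: "l = ennreal (integral {0..1} (\<lambda>t. norm (\<xi>' t)))"
      and \<xi>: "C1_curve (closure \<Omega>) x y \<xi> \<xi>'" by blast
    define L where "L = integral {0..1} (\<lambda>t. norm (\<xi>' t))"
    obtain \<gamma> where L: "0 \<le> L" and \<gamma>: "\<gamma> 0 = x" "\<gamma> L = y" "\<gamma> ` {0..L} \<subseteq> closure \<Omega>"
      and lip: "\<And>u v. u \<in> {0..L} \<Longrightarrow> v \<in> {0..L} \<Longrightarrow> norm (\<gamma> u - \<gamma> v) \<le> \<bar>u - v\<bar>"
      using C1_curve_lipschitz_reparametrisation[OF \<xi>] unfolding L_def by blast
    have "graph_dist \<eta> h \<Omega>n x (\<gamma> L) \<le> ennreal ((1 + 2 * \<delta> / (?\<rho> - 2 * \<delta>)) * L + ?\<tau>)"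
    proof (rule cost_along_lipschitz_curve[where V = \<Omega>n])
      show "graph_dist \<eta> h \<Omega>n x (\<gamma> 0) = 0" using \<gamma> by (simp add: graph_dist_def)
      show "\<exists>v\<in>\<Omega>n. norm (\<gamma> u - v) \<le> \<delta>" if "u \<in> {0..L}" for u
        using near \<gamma>(3) that by blast
      show "2 * \<delta> < ?\<rho>" using quarter \<delta> \<rho> by linarith
      show "\<gamma> 0 \<in> \<Omega>n" "\<gamma> L \<in> \<Omega>n" using \<gamma>(1,2) assms(15,16) by simp_all
    qed (fact lip L \<delta> \<tau> | rule graph_dist_hop[OF assms(11,12,15)], assumption+)+
    also have "\<dots> \<le> ennreal (?c * L + ?\<tau>)"
      using factor L by (intro ennreal_leI add_right_mono mult_right_mono)
    also have "\<dots> = ennreal ?c * l + ennreal ?\<tau>"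
      using c L \<tau> by (simp add: l L_def[symmetric] ennreal_plus ennreal_mult less_imp_le)
    finally show "graph_dist \<eta> h \<Omega>n x y \<le> ennreal ?c * l + ennreal ?\<tau>"
      using \<gamma> by simp
  qed
qed

end
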